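(* If $\Psi=(E,\Delta)$ is a rank-$r$ ordered simplicial complex in both QE and QC, then $$h(\mathrm{nbc}(\Psi),x)=x^{r}\,T(\Psi,x^{-1},0).$$
   Context: An ordered simplicial complex is a pair $\Psi=(E,\Delta)$ with $E$ a finite totally ordered set and $\Delta\subseteq 2^E$ a simplicial complex (closed under taking subsets, $\emptyset\in\Delta$). Elements of $\Delta$ are independent sets; inclusion-maximal ones are bases; inclusion-minimal subsets of $E$ not in $\Delta$ are circuits. $\Psi$ is pure if all bases have the same cardinality; its rank is the maximal cardinality of an independent set. The lexicographic order on subsets is the dictionary order on increasingly sorted lists. QE: the class of $\Psi$ that are pure and such that for all bases $B_1,B_2$ and $b_1\in B_1\setminus B_2$ with $b_1>\max(B_2\setminus B_1)$, there is $b_2\in B_2\setminus B_1$ with $(B_1\setminus\{b_1\})\cup\{b_2\}\in\Delta$. QC: the class of $\Psi$ such that if $C_1\neq C_2$ are circuits and $c\in C_1\cap C_2$ satisfies $c<\max (C_1\triangle C_2)$, then there is a circuit $C_3\subseteq (C_1\cup C_2)\setminus\{c\}$. A broken circuit of $\Psi$ is a set $C\setminus\{c\}$ where $C$ is a circuit and $c$ is the smallest element of $C$. $\mathrm{nbc}(\Psi)$ is the complex on $E$ whose bases are the bases of $\Psi$ containing no broken circuit (void, with no independent sets and $h$-polynomial $0$, if there are none). For a basis $B$: $b\in B$ is internally active if $B$ is the lexicographically smallest basis containing $B\setminus\{b\}$; $IA(B)$ is the set of these. An element $e\in E\setminus B$ is externally active if some circuit $C\subseteq B\cup\{e\}$ has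 smallest element $e$; $EA(B)$ is the set of these. $T(\Psi,x,y)=\sum_{B}x^{|IA(B)|}y^{|EA(B)|}$, sum over the bases of $\Psi$ (with $0^0=1$). For a rank-$d$ complex with $f_j$ independent sets of cardinality $j$, the $h$-polynomial is $h(\cdot,x)=\sum_{j=0}^d f_j x^j(1-x)^{d-j}$. *)

theory Defs
  imports Complex_Main
begin

text \<open>
  The finite totally ordered ground set \<open>E\<close> is a finite subset of an arbitrary linearly ordered
  type; a complex on \<open>E\<close> is given by its set \<open>\<Delta>\<close> of independent sets.
\<close>

definition ordered_complex :: "'e::linorder set \<Rightarrow> 'e set set \<Rightarrow> bool" where
  "ordered_complex E \<Delta> \<longleftrightarrow>
     finite E \<and> \<Delta> \<subseteq> Pow E \<and> {} \<in> \<Delta> \<and> (\<forall>I\<in>\<Delta>. \<forall>J. J \<subseteq> I \<longrightarrow> J \<in> \<Delta>)"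

definition bases :: "'e set set \<Rightarrow> 'e set set" where
  "bases \<Delta> = {B \<in> \<Delta>. \<forall>I\<in>\<Delta>. B \<subseteq> I \<longrightarrow> I = B}"

definition circuits :: "'e set \<Rightarrow> 'e set set \<Rightarrow> 'e set set" where
  "circuits E \<Delta> = {C. C \<subseteq> E \<and> C \<notin> \<Delta> \<and> (\<forall>D. D \<subset> C \<longrightarrow> D \<in> \<Delta>)}"

definition pure_complex :: "'e set set \<Rightarrow> bool" where
  "pure_complex \<Delta> \<longleftrightarrow> (\<forall>B\<^sub>1\<in>bases \<Delta>. \<forall>B\<^sub>2\<in>bases \<Delta>. card B\<^sub>1 = card B\<^sub>2)"

text \<open>The value \<open>0\<close> for the void complex is a convention that affects nothing below.\<close>

definition complex_rank :: "'e set set \<Rightarrow> nat" where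
  "complex_rank \<Delta> = (if \<Delta> = {} then 0 else Max (card ` \<Delta>))"

definition lex_less :: "'e::linorder set \<Rightarrow> 'e set \<Rightarrow> bool" where
  "lex_less A B \<longleftrightarrow> (sorted_list_of_set A, sorted_list_of_set B) \<in> lexord {(a, b). a < b}"

text \<open>
  Both uses of \<open>Max\<close> below are on nonempty sets: distinct bases are incomparable, and distinct
  circuits have a nonempty symmetric difference.
\<close>

definition QE :: "'e::linorder set \<Rightarrow> 'e set set \<Rightarrow> bool" where
  "QE E \<Delta> \<longleftrightarrow> ordered_complex E \<Delta> \<and> pure_complex \<Delta> \<and>
     (\<forall>B\<^sub>1\<in>bases \<Delta>. \<forall>B\<^sub>2\<in>bases \<Delta>. \<forall>b\<^sub>1\<in>B\<^sub>1 - B\<^sub>2. b\<^sub>1 > Max (B\<^sub>2 - B\<^sub>1) \<longrightarrow>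
        (\<exists>b\<^sub>2\<in>B\<^sub>2 - B\<^sub>1. (B\<^sub>1 - {b\<^sub>1}) \<union> {b\<^sub>2} \<in> \<Delta>))"

definition QC :: "'e::linorder set \<Rightarrow> 'e set set \<Rightarrow> bool" where
  "QC E \<Delta> \<longleftrightarrow> ordered_complex E \<Delta> \<and>
     (\<forall>C\<^sub>1\<in>circuits E \<Delta>. \<forall>C\<^sub>2\<in>circuits E \<Delta>. \<forall>c\<in>C\<^sub>1 \<inter> C\<^sub>2.
        C\<^sub>1 \<noteq> C\<^sub>2 \<and> c < Max ((C\<^sub>1 - C\<^sub>2) \<union> (C\<^sub>2 - C\<^sub>1)) \<longrightarrow>
        (\<exists>C\<^sub>3\<in>circuits E \<Delta>. C\<^sub>3 \<subseteq> (C\<^sub>1 \<union> C\<^sub>2) - {c}))"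

definition broken_circuits :: "'e::linorder set \<Rightarrow> 'e set set \<Rightarrow> 'e set set" where
  "broken_circuits E \<Delta> = {C - {Min C} | C. C \<in> circuits E \<Delta>}"

text \<open>
  The complex generated by the bases that contain no broken circuit. As bases form an antichain,
  these are exactly its bases; it is \<open>{}\<close>, the void complex, if there are none.
\<close>

definition nbc :: "'e::linorder set \<Rightarrow> 'e set set \<Rightarrow> 'e set set" where
  "nbc E \<Delta> = {I. \<exists>B\<in>bases \<Delta>. (\<forall>D\<in>broken_circuits E \<Delta>. \<not> D \<subseteq> B) \<and> I \<subseteq> B}"

definition IA :: "'e::linorder set set \<Rightarrow> 'e set \<Rightarrow> 'e set" where
  "IA \<Delta> B = {b \<in> B. \<forall>B'\<in>bases \<Delta>. B - {b} \<subseteq> B' \<and> B' \<noteq> B \<longrightarrow> lex_less B B'}"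

definition EA :: "'e::linorder set \<Rightarrow> 'e set set \<Rightarrow> 'e set \<Rightarrow> 'e set" where
  "EA E \<Delta> B = {e \<in> E - B. \<exists>C\<in>circuits E \<Delta>. C \<subseteq> B \<union> {e} \<and> e \<in> C \<and> (\<forall>c\<in>C. e \<le> c)}"

text \<open>
  The polynomials \<open>T\<close> and \<open>h\<close> are given by their values in an arbitrary commutative ring; the
  values at indeterminates, in a polynomial ring or its fraction field, are the formal polynomials.
\<close>

definition tutte :: "'e::linorder set \<Rightarrow> 'e set set \<Rightarrow> 'a::comm_ring_1 \<Rightarrow> 'a \<Rightarrow> 'a" where
  "tutte E \<Delta> x y = (\<Sum>B\<in>bases \<Delta>. x ^ card (IA \<Delta> B) * y ^ card (EA E \<Delta> B))"

definition f_number :: "'e set set \<Rightarrow> nat \<Rightarrow> nat" where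
  "f_number \<Delta> j = card {I \<in> \<Delta>. card I = j}"

text \<open>For the void complex every \<open>f_number\<close> is \<open>0\<close>, so its \<open>h\<close>-polynomial is \<open>0\<close>.\<close>

definition h_polynomial :: "'e set set \<Rightarrow> 'a::comm_ring_1 \<Rightarrow> 'a" where
  "h_polynomial \<Delta> x =
     (\<Sum>j = 0..complex_rank \<Delta>. of_nat (f_number \<Delta> j) * x ^ j * (1 - x) ^ (complex_rank \<Delta> - j))"

end

theory Submission
  imports Defs
begin

text \<open>
  A basis contains no broken circuit iff it has no externally active element, so \<open>T(\<Psi>, -, 0)\<close> is a
  sum over exactly the bases of \<open>nbc(\<Psi>)\<close>, and it suffices that the intervals
  \<open>[B - IA(B), B]\<close> over these bases partition \<open>nbc(\<Psi>)\<close>: each contributes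
  \<open>x ^ |B - IA(B)| * (x + (1 - x)) ^ |IA(B)|\<close> to the \<open>h\<close>-polynomial.
  If two bases \<open>B\<^sub>1, B\<^sub>2\<close> had a common set in their intervals, QE applied to the largest element of
  their symmetric difference would produce an internally passive element of one outside the other.
  A face \<open>I\<close> lies in the interval of the lexicographically smallest basis \<open>B \<supseteq> I\<close>.
  If \<open>C - {Min C} \<subseteq> B\<close> for a circuit \<open>C\<close>, then by QC \<open>C\<close> is the only circuit in
  \<open>B \<union> {Min C}\<close>, so any element of \<open>C - {Min C}\<close> outside \<open>I\<close> could be exchanged for the smaller
  \<open>Min C\<close>, against minimality; hence \<open>C - {Min C} \<subseteq> I\<close>, and no basis containing \<open>I\<close> is nbc.
\<close>

definition nbc_bases :: "'e::linorder set \<Rightarrow> 'e set set \<Rightarrow> 'e set set" where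
  "nbc_bases E \<Delta> = {B \<in> bases \<Delta>. \<forall>D\<in>broken_circuits E \<Delta>. \<not> D \<subseteq> B}"

lemma nbc_eq_UN_Pow: "nbc E \<Delta> = (\<Union>B\<in>nbc_bases E \<Delta>. Pow B)"
  by (auto simp: nbc_def nbc_bases_def)

section \<open>Lexicographic order\<close>

lemma lex_less_trans: "lex_less A B \<Longrightarrow> lex_less B C \<Longrightarrow> lex_less A C"
  unfolding lex_less_def by (erule lexord_trans) (auto simp: trans_def)

lemma lex_less_irrefl: "\<not> lex_less A A"
  unfolding lex_less_def by (rule lexord_irreflexive) auto

lemma lex_less_linear:
  assumes "finite A" "finite B"
  shows "lex_less A B \<or> A = B \<or> lex_less B A"
proof -
  have "lex_less A B \<or> sorted_list_of_set A = sorted_list_of_set B \<or> lex_less B A"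
    unfolding lex_less_def by (rule lexord_linear) auto
  then show ?thesis
    using assms by (metis sorted_list_of_set.set_sorted_key_list_of_set)
qed

text \<open>The two lists agree up to the place of \<open>a\<close>. There the second list has
  \<open>b\<close> or an element of \<open>xs\<close>, and either one exceeds \<open>a\<close>
  because \<open>a \<notin> set xs\<close>.\<close>

lemma lexord_insort:
  fixes a b :: "'e::linorder"
  assumes "a < b" "a \<notin> set xs"
  shows "(insort a xs, insort b xs) \<in> lexord {(a, b). a < b}"
  using assms by (induction xs) auto

lemma lex_less_insert:
  assumes "finite X" "a \<notin> X" "b \<notin> X" "a < b"
  shows "lex_less (insert a X) (insert b X)"
  using assms lexord_insort[of a b "sorted_list_of_set X"] by (simp add: lex_less_def)

section \<open>Bases and circuits\<close>

locale finite_complex =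
  fixes E :: "'e::linorder set" and \<Delta> :: "'e set set"
  assumes ordered_complex: "ordered_complex E \<Delta>"
begin

lemma finite_E: "finite E"
  and indep_subset_E: "I \<in> \<Delta> \<Longrightarrow> I \<subseteq> E"
  and empty_indep: "{} \<in> \<Delta>"
  and indep_mono: "I \<in> \<Delta> \<Longrightarrow> J \<subseteq> I \<Longrightarrow> J \<in> \<Delta>"
  using ordered_complex by (auto simp: ordered_complex_def)

lemma finite_indep: "I \<in> \<Delta> \<Longrightarrow> finite I"
  using finite_E indep_subset_E finite_subset by blast

lemma finite_complex: "finite \<Delta>"
  using finite_E indep_subset_E by (meson Pow_iff finite_Pow_iff finite_subset subsetI)

lemma basis_indep: "B \<in> bases \<Delta> \<Longrightarrow> B \<in> \<Delta>"
  by (simp add: bases_def)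

lemma finite_bases: "finite (bases \<Delta>)"
  using finite_complex by (simp add: bases_def)

lemma finite_basis: "B \<in> bases \<Delta> \<Longrightarrow> finite B"
  by (simp add: basis_indep finite_indep)

lemma basis_antichain: "B \<in> bases \<Delta> \<Longrightarrow> B' \<in> bases \<Delta> \<Longrightarrow> B \<subseteq> B' \<Longrightarrow> B = B'"
  unfolding bases_def by blast

lemma indep_subset_basis:
  assumes "I \<in> \<Delta>"
  shows "\<exists>B\<in>bases \<Delta>. I \<subseteq> B"
proof -
  obtain B where "B \<in> \<Delta>" "I \<subseteq> B" "\<forall>J\<in>\<Delta>. B \<subseteq> J \<longrightarrow> B = J"
    using finite_has_maximal2[OF finite_complex assms] by blast
  then show ?thesis
    by (auto simp: bases_def)
qed

lemma dependent_contains_circuit: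
  assumes "A \<subseteq> E" "A \<notin> \<Delta>"
  shows "\<exists>C\<in>circuits E \<Delta>. C \<subseteq> A"
proof -
  have "finite {D. D \<subseteq> A \<and> D \<notin> \<Delta>}"
    using assms(1) finite_E by (auto intro: finite_subset[of _ "Pow E"])
  moreover have "A \<in> {D. D \<subseteq> A \<and> D \<notin> \<Delta>}"
    using assms(2) by simp
  ultimately obtain C where "C \<subseteq> A" "C \<notin> \<Delta>"
    and min: "\<forall>D\<in>{D. D \<subseteq> A \<and> D \<notin> \<Delta>}. D \<subseteq> C \<longrightarrow> C = D"
    using finite_has_minimal2[of "{D. D \<subseteq> A \<and> D \<notin> \<Delta>}" A] by blast
  moreover have "D \<in> \<Delta>" if "D \<subset> C" for D
    using min that \<open>C \<subseteq> A\<close> by blast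
  ultimately show ?thesis
    using assms(1) unfolding circuits_def by blast
qed

lemma circuit_not_subset_indep: "C \<in> circuits E \<Delta> \<Longrightarrow> I \<in> \<Delta> \<Longrightarrow> \<not> C \<subseteq> I"
  using indep_mono by (auto simp: circuits_def)

lemma circuit_finite_nonempty: "C \<in> circuits E \<Delta> \<Longrightarrow> finite C \<and> C \<noteq> {}"
  using finite_E finite_subset empty_indep by (auto simp: circuits_def)

text \<open>If \<open>C - {Min C}\<close> fits into a basis \<open>B\<close>, then
  \<open>Min C\<close> is outside \<open>B\<close>, since an independent set contains no circuit;
  this \<open>Min C\<close> is the externally active element. Setting \<open>y = 0\<close> in
  \<open>tutte\<close> thus selects the nbc bases.\<close>

lemma nbc_bases_eq: "nbc_bases E \<Delta> = {B \<in> bases \<Delta>. EA E \<Delta> B = {}}"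
proof -
  have "(\<forall>D\<in>broken_circuits E \<Delta>. \<not> D \<subseteq> B) \<longleftrightarrow> EA E \<Delta> B = {}" if B: "B \<in> bases \<Delta>" for B
  proof
    assume nb: "\<forall>D\<in>broken_circuits E \<Delta>. \<not> D \<subseteq> B"
    show "EA E \<Delta> B = {}"
    proof (rule equals0I)
      fix e assume "e \<in> EA E \<Delta> B"
      then obtain C where C: "C \<in> circuits E \<Delta>" "C \<subseteq> B \<union> {e}" "e \<in> C" "\<forall>c\<in>C. e \<le> c"
        by (auto simp: EA_def)
      have "Min C = e"
        using C circuit_finite_nonempty by (intro Min_eqI) auto
      then have "C - {e} \<in> broken_circuits E \<Delta>"
        using C(1) by (auto simp: broken_circuits_def)
      then show False
        using nb C(2) by auto
    qed
  next
    assume ea: "EA E \<Delta> B = {}"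
    show "\<forall>D\<in>broken_circuits E \<Delta>. \<not> D \<subseteq> B"
    proof (intro ballI notI)
      fix D assume "D \<in> broken_circuits E \<Delta>" "D \<subseteq> B"
      then obtain C where C: "C \<in> circuits E \<Delta>" "C - {Min C} \<subseteq> B"
        by (auto simp: broken_circuits_def)
      have "Min C \<in> C" "\<forall>c\<in>C. Min C \<le> c"
        using circuit_finite_nonempty[OF C(1)] by auto
      moreover have "Min C \<notin> B"
        using C circuit_not_subset_indep basis_indep[OF B] by blast
      moreover have "C \<subseteq> E"
        using C(1) by (simp add: circuits_def)
      ultimately have "Min C \<in> EA E \<Delta> B"
        using C unfolding EA_def by auto
      then show False
        using ea by simp
    qed
  qed
  then show ?thesis
    by (auto simp: nbc_bases_def)
qed

text \<open>Take \<open>B\<close> lexicographically smallest above \<open>I\<close>. For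
  \<open>b \<in> B - I\<close>, every basis containing \<open>B - {b}\<close> also contains
  \<open>I\<close>, so it cannot precede \<open>B\<close>, and \<open>b\<close> is internally
  active.\<close>

lemma lex_min_basis_exists:
  assumes "I \<in> \<Delta>"
  shows "\<exists>B\<in>bases \<Delta>. I \<subseteq> B \<and> B - IA \<Delta> B \<subseteq> I"
proof -
  let ?S = "{B \<in> bases \<Delta>. I \<subseteq> B}"
  have "asymp_on ?S lex_less" "transp_on ?S lex_less"
    using lex_less_trans lex_less_irrefl by (blast intro: asymp_onI transp_onI)+
  moreover have "finite ?S" "?S \<noteq> {}"
    using finite_bases indep_subset_basis[OF assms] by auto
  ultimately have "\<exists>B\<in>?S. \<forall>B'\<in>?S. B' \<noteq> B \<longrightarrow> \<not> lex_less B' B"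
    by (intro Finite_Set.bex_min_element)
  then obtain B where B: "B \<in> bases \<Delta>" "I \<subseteq> B"
    and min: "\<And>B'. B' \<in> bases \<Delta> \<Longrightarrow> I \<subseteq> B' \<Longrightarrow> B' \<noteq> B \<Longrightarrow> \<not> lex_less B' B"
    by auto
  have "b \<in> IA \<Delta> B" if "b \<in> B - I" for b
  proof -
    have "lex_less B B'" if B': "B' \<in> bases \<Delta>" "B - {b} \<subseteq> B'" "B' \<noteq> B" for B'
    proof -
      have "I \<subseteq> B'"
        using B(2) \<open>b \<in> B - I\<close> B'(2) by auto
      then show ?thesis
        using B B' min[of B'] lex_less_linear[of B B'] finite_basis by blast
    qed
    then show ?thesis
      using that by (simp add: IA_def)
  qed
  then show ?thesis
    using B by blast
qed

end

section \<open>Pure complexes\<close>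

locale pure_finite_complex = finite_complex +
  assumes pure: "pure_complex \<Delta>"
begin

lemma card_basis:
  assumes B: "B \<in> bases \<Delta>"
  shows "card B = complex_rank \<Delta>"
proof -
  have "card I \<le> card B" if I: "I \<in> \<Delta>" for I
  proof -
    obtain B' where "B' \<in> bases \<Delta>" "I \<subseteq> B'"
      using indep_subset_basis[OF I] by blast
    then show ?thesis
      using B pure card_mono[OF finite_basis] by (metis pure_complex_def)
  qed
  moreover have "B \<in> \<Delta>"
    using B by (rule basis_indep)
  ultimately show ?thesis
    using finite_complex unfolding complex_rank_def
    by (auto intro!: Max_eqI[symmetric])
qed

lemma indep_card_eq_imp_basis:
  assumes "B \<in> bases \<Delta>" "I \<in> \<Delta>" "card I = card B"
  shows "I \<in> bases \<Delta>"
  using indep_subset_basis[OF assms(2)] assms card_basis finite_basis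
  by (metis card_subset_eq)

lemma exchange_basis:
  assumes "B \<in> bases \<Delta>" "b \<in> B" "a \<notin> B" "insert a (B - {b}) \<in> \<Delta>"
  shows "insert a (B - {b}) \<in> bases \<Delta>"
proof -
  have "card (insert a (B - {b})) = card B"
    using finite_basis[OF assms(1)] assms(2,3) card_Suc_Diff1[of B b] by simp
  then show ?thesis
    using indep_card_eq_imp_basis assms(1,4) by blast
qed

text \<open>By purity the exchange yields a basis; it contains \<open>B - {b}\<close> and precedes
  \<open>B\<close>. QE and QC both act on \<open>IA\<close> through such exchanges.\<close>

lemma internally_passive_if_smaller_exchange:
  assumes "B \<in> bases \<Delta>" "b \<in> B" "a \<notin> B" "a < b" "insert a (B - {b}) \<in> \<Delta>"
  shows "b \<notin> IA \<Delta> B"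
proof
  let ?B' = "insert a (B - {b})"
  assume "b \<in> IA \<Delta> B"
  moreover have "?B' \<in> bases \<Delta>"
    using exchange_basis assms by blast
  ultimately have "lex_less B ?B'"
    using assms(3) by (auto simp: IA_def)
  moreover have "lex_less ?B' (insert b (B - {b}))"
    using lex_less_insert[of "B - {b}" a b] finite_basis assms by auto
  ultimately show False
    using assms(2) lex_less_trans lex_less_irrefl by (metis insert_Diff)
qed

text \<open>If \<open>nbc E \<Delta>\<close> is void, its rank is not that of \<open>\<Delta>\<close>, but both sides vanish.\<close>

lemma h_polynomial_nbc_eq_sum:
  fixes x :: "'b::comm_ring_1"
  shows "h_polynomial (nbc E \<Delta>) x
    = (\<Sum>I\<in>nbc E \<Delta>. x ^ card I * (1 - x) ^ (complex_rank \<Delta> - card I))"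
proof (cases "nbc E \<Delta> = {}")
  case True
  then show ?thesis
    by (simp add: h_polynomial_def f_number_def)
next
  case False
  let ?r = "complex_rank \<Delta>"
  let ?N = "nbc E \<Delta>"
  have "?N \<subseteq> \<Delta>"
    using indep_mono basis_indep by (auto simp: nbc_def)
  then have finN: "finite ?N"
    using finite_complex finite_subset by blast
  have le: "card I \<le> ?r" if I: "I \<in> ?N" for I
  proof -
    obtain B where "B \<in> bases \<Delta>" "I \<subseteq> B"
      using I by (auto simp: nbc_def)
    then show ?thesis
      using card_mono[OF finite_basis] card_basis by metis
  qed
  \<comment> \<open>A nonvoid nbc complex contains a whole basis of \<open>\<Delta>\<close>, which
    attains the bound \<open>le\<close>.\<close>
  obtain B where "B \<in> bases \<Delta>" "B \<in> ?N"
    using False by (auto simp: nbc_def)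
  then have "?r \<in> card ` ?N"
    using card_basis by (metis image_eqI)
  then have "Max (card ` ?N) = ?r"
    using finN le by (intro Max_eqI) auto
  then have rank: "complex_rank ?N = ?r"
    using False by (simp add: complex_rank_def[of ?N])
  have "h_polynomial ?N x
      = (\<Sum>j = 0..?r. \<Sum>I | I \<in> ?N \<and> card I = j. x ^ card I * (1 - x) ^ (?r - card I))"
    unfolding h_polynomial_def rank f_number_def
  proof (rule sum.cong[OF refl])
    fix j
    have "(\<Sum>I | I \<in> ?N \<and> card I = j. x ^ card I * (1 - x) ^ (?r - card I))
        = (\<Sum>I | I \<in> ?N \<and> card I = j. x ^ j * (1 - x) ^ (?r - j))"
      by (rule sum.cong) auto
    then show "of_nat (card {I \<in> ?N. card I = j}) * x ^ j * (1 - x) ^ (?r - j)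
        = (\<Sum>I | I \<in> ?N \<and> card I = j. x ^ card I * (1 - x) ^ (?r - card I))"
      by (simp add: mult.assoc)
  qed
  also have "\<dots> = (\<Sum>I\<in>?N. x ^ card I * (1 - x) ^ (?r - card I))"
    using finN le by (intro sum.group) auto
  finally show ?thesis .
qed

end

text \<open>Via \<open>I = A \<union> J\<close> with \<open>J \<subseteq> B - A\<close>, the factor
  \<open>x ^ card A\<close> splits off. What remains is the expansion over subsets of a product of
  factors \<open>x + (1 - x) = 1\<close>.\<close>

lemma sum_interval_powers:
  fixes x :: "'a::comm_ring_1"
  assumes "finite B" "A \<subseteq> B"
  shows "(\<Sum>I | A \<subseteq> I \<and> I \<subseteq> B. x ^ card I * (1 - x) ^ (card B - card I)) = x ^ card A"
proof -
  let ?D = "B - A"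
  have fin: "finite A" "finite ?D"
    using assms finite_subset by auto
  have "(\<Sum>I | A \<subseteq> I \<and> I \<subseteq> B. x ^ card I * (1 - x) ^ (card B - card I))
      = (\<Sum>J\<in>Pow ?D. x ^ card A * (x ^ card J * (1 - x) ^ card (?D - J)))"
  proof (rule sum.reindex_bij_witness[where i = "\<lambda>J. A \<union> J" and j = "\<lambda>I. I - A"])
    fix I assume I: "I \<in> {I. A \<subseteq> I \<and> I \<subseteq> B}"
    then have finI: "finite I"
      using assms(1) finite_subset by blast
    have "?D - (I - A) = B - I"
      using I by auto
    then have "card (?D - (I - A)) = card B - card I"
      using I finI by (simp add: card_Diff_subset)
    moreover have "card I = card A + card (I - A)"
      using I fin finI card_Un_disjoint[of A "I - A"] by (auto simp: Un_absorb1)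
    ultimately show "x ^ card A * (x ^ card (I - A) * (1 - x) ^ card (?D - (I - A)))
        = x ^ card I * (1 - x) ^ (card B - card I)"
      by (simp add: power_add mult.assoc)
  qed (use assms in auto)
  also have "\<dots> = x ^ card A * (\<Sum>J\<in>Pow ?D. x ^ card J * (1 - x) ^ card (?D - J))"
    by (simp add: sum_distrib_left)
  also have "(\<Sum>J\<in>Pow ?D. x ^ card J * (1 - x) ^ card (?D - J)) = (\<Prod>_\<in>?D. x + (1 - x))"
    unfolding prod_add[OF fin(2)] by simp
  finally show ?thesis
    by simp
qed

section \<open>The partition of the nbc complex\<close>

lemma QE_intervals_disjoint:
  assumes "QE E \<Delta>" "B\<^sub>1 \<in> bases \<Delta>" "B\<^sub>2 \<in> bases \<Delta>"
    and "B\<^sub>1 - IA \<Delta> B\<^sub>1 \<subseteq> I" "I \<subseteq> B\<^sub>1" "B\<^sub>2 - IA \<Delta> B\<^sub>2 \<subseteq> I" "I \<subseteq> B\<^sub>2"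
  shows "B\<^sub>1 = B\<^sub>2"
proof (rule ccontr)
  interpret pure_finite_complex E \<Delta>
    using assms(1) by unfold_locales (auto simp: QE_def)
  \<comment> \<open>Asymmetric core, to be used with the two bases in either order: all of
    \<open>B - B'\<close> is internally active in \<open>B\<close>, while QE would exchange its
    element \<open>b\<close> for a smaller one.\<close>
  have no_max: False
    if B: "B \<in> bases \<Delta>" "B' \<in> bases \<Delta>" "B - IA \<Delta> B \<subseteq> B'" and b: "b \<in> B - B'"
      and max: "\<And>c. c \<in> B' - B \<Longrightarrow> c \<le> b" for B B' b
  proof -
    have "B' - B \<noteq> {}"
      using B b basis_antichain by blast
    moreover have "finite (B' - B)"
      using B finite_basis by auto
    moreover have "c < b" if "c \<in> B' - B" for c
      using max[OF that] that b by (auto simp: order.order_iff_strict)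
    ultimately have "Max (B' - B) < b"
      by simp
    then obtain a where "a \<in> B' - B" "(B - {b}) \<union> {a} \<in> \<Delta>"
      using assms(1) B b unfolding QE_def by blast
    then have "b \<notin> IA \<Delta> B"
      using internally_passive_if_smaller_exchange[of B b a] B b
        \<open>\<And>c. c \<in> B' - B \<Longrightarrow> c < b\<close> by auto
    then show False
      using B b by blast
  qed
  let ?S = "(B\<^sub>1 - B\<^sub>2) \<union> (B\<^sub>2 - B\<^sub>1)"
  assume "B\<^sub>1 \<noteq> B\<^sub>2"
  then have "finite ?S" "?S \<noteq> {}"
    using assms finite_basis by auto
  then have "Max ?S \<in> ?S" "\<And>c. c \<in> ?S \<Longrightarrow> c \<le> Max ?S"
    by (rule Max_in, intro Max_ge)
  \<comment> \<open>The maximum lies in one of the two differences. Since each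
    \<open>B - IA \<Delta> B\<close> is inside \<open>I\<close>, it is inside the other basis, so
    \<open>no_max\<close> applies in one of the two orders.\<close>
  then show False
    using no_max[of B\<^sub>1 B\<^sub>2 "Max ?S"] no_max[of B\<^sub>2 B\<^sub>1 "Max ?S"] assms by blast
qed

text \<open>Both circuits contain \<open>e\<close>, as neither fits into \<open>B\<close>. Distinct
  circuits are incomparable, so some element of \<open>C - C'\<close> lies above \<open>e\<close>;
  QC then eliminates \<open>e\<close> and leaves a circuit inside the independent set
  \<open>B\<close>.\<close>

lemma QC_unique_circuit:
  assumes "QC E \<Delta>" "B \<in> \<Delta>" "C \<in> circuits E \<Delta>" "C \<subseteq> insert e B" "e \<in> C" "\<forall>c\<in>C. e \<le> c"
    and C': "C' \<in> circuits E \<Delta>" "C' \<subseteq> insert e B"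
  shows "C' = C"
proof (rule ccontr)
  interpret finite_complex E \<Delta>
    using assms(1) by unfold_locales (auto simp: QC_def)
  assume ne: "C' \<noteq> C"
  let ?S = "(C - C') \<union> (C' - C)"
  have e: "e \<in> C'"
    using C' assms(2) circuit_not_subset_indep by blast
  have "\<not> C \<subseteq> C'"
    using ne assms(3) C'(1) unfolding circuits_def by blast
  then obtain c where c: "c \<in> C - C'"
    by blast
  then have "e < c"
    using e assms(6) by (auto simp: order.order_iff_strict)
  also have "c \<le> Max ?S"
    using c assms(3) C'(1) circuit_finite_nonempty by (intro Max_ge) auto
  finally obtain C\<^sub>3 where "C\<^sub>3 \<in> circuits E \<Delta>" "C\<^sub>3 \<subseteq> (C \<union> C') - {e}"
    using assms(1,3,5) C'(1) e ne unfolding QC_def by blast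
  then show False
    using circuit_not_subset_indep assms(2,4) C'(2) by blast
qed

lemma QE_QC_lex_min_basis_nbc:
  assumes "QE E \<Delta>" "QC E \<Delta>" "I \<in> nbc E \<Delta>"
    and B: "B \<in> bases \<Delta>" "B - IA \<Delta> B \<subseteq> I"
  shows "B \<in> nbc_bases E \<Delta>"
proof (rule ccontr)
  interpret pure_finite_complex E \<Delta>
    using assms(1) by unfold_locales (auto simp: QE_def)
  assume "B \<notin> nbc_bases E \<Delta>"
  then obtain e C where e: "e \<in> E" "e \<notin> B"
    and C: "C \<in> circuits E \<Delta>" "C \<subseteq> insert e B" "e \<in> C" "\<forall>c\<in>C. e \<le> c"
    using B(1) by (auto simp: nbc_bases_eq EA_def)
  have "c \<in> I" if c: "c \<in> C - {e}" for c
  proof -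
    \<comment> \<open>A circuit in this set would have to be \<open>C\<close> by uniqueness, but
      \<open>c \<in> C\<close> has been removed.\<close>
    have "insert e (B - {c}) \<in> \<Delta>"
    proof (rule ccontr)
      assume "insert e (B - {c}) \<notin> \<Delta>"
      moreover have "insert e (B - {c}) \<subseteq> E"
        using e(1) B(1) basis_indep indep_subset_E by blast
      ultimately obtain C' where "C' \<in> circuits E \<Delta>" "C' \<subseteq> insert e (B - {c})"
        using dependent_contains_circuit by blast
      moreover from this have "C' = C"
        using QC_unique_circuit[OF assms(2) basis_indep[OF B(1)] C, of C'] by blast
      ultimately show False
        using c by auto
    qed
    moreover have "e < c"
      using c C(4) by (auto simp: order.order_iff_strict)
    ultimately have "c \<notin> IA \<Delta> B"
      using internally_passive_if_smaller_exchange[OF B(1)] c C(2) e(2) by blast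
    then show ?thesis
      using B(2) c C(2) by blast
  qed
  \<comment> \<open>All of \<open>C - {e}\<close> now lies in \<open>I\<close>, so any nbc basis
    above \<open>I\<close> contains this broken circuit.\<close>
  moreover obtain B\<^sub>0 where "B\<^sub>0 \<in> nbc_bases E \<Delta>" "I \<subseteq> B\<^sub>0"
    using assms(3) by (auto simp: nbc_eq_UN_Pow)
  moreover have "Min C = e"
    using C circuit_finite_nonempty by (intro Min_eqI) auto
  then have "C - {e} \<in> broken_circuits E \<Delta>"
    using C(1) by (auto simp: broken_circuits_def)
  ultimately show False
    unfolding nbc_bases_def by blast
qed

theorem corollary6p6:
  fixes E :: "'e::linorder set" and \<Delta> :: "'e set set" and r :: nat and x :: "'a::field"
  assumes "ordered_complex E \<Delta>" and "complex_rank \<Delta> = r"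
    and "QE E \<Delta>" and "QC E \<Delta>"
    and "x \<noteq> 0"
  shows "h_polynomial (nbc E \<Delta>) x = x ^ r * tutte E \<Delta> (inverse x) 0"
proof -
  interpret pure_finite_complex E \<Delta>
    using assms(3) by unfold_locales (auto simp: QE_def)
  let ?N = "nbc_bases E \<Delta>"
  let ?int = "\<lambda>B. {I. B - IA \<Delta> B \<subseteq> I \<and> I \<subseteq> B}"
  let ?w = "\<lambda>I. x ^ card I * (1 - x) ^ (r - card I)"
  have N: "?N \<subseteq> bases \<Delta>"
    by (auto simp: nbc_bases_def)
  have cover: "nbc E \<Delta> = (\<Union>B\<in>?N. ?int B)"
  proof
    show "nbc E \<Delta> \<subseteq> (\<Union>B\<in>?N. ?int B)"
    proof
      fix I assume I: "I \<in> nbc E \<Delta>"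
      then have "I \<in> \<Delta>"
        using indep_mono basis_indep by (auto simp: nbc_def)
      then obtain B where "B \<in> bases \<Delta>" "I \<subseteq> B" "B - IA \<Delta> B \<subseteq> I"
        using lex_min_basis_exists by blast
      then show "I \<in> (\<Union>B\<in>?N. ?int B)"
        using QE_QC_lex_min_basis_nbc[OF assms(3,4) I] by blast
    qed
  qed (auto simp: nbc_eq_UN_Pow)
  have "h_polynomial (nbc E \<Delta>) x = (\<Sum>I\<in>(\<Union>B\<in>?N. ?int B). ?w I)"
    by (simp add: h_polynomial_nbc_eq_sum assms(2) flip: cover)
  also have "\<dots> = (\<Sum>B\<in>?N. \<Sum>I\<in>?int B. ?w I)"
  proof (rule sum.UNION_disjoint)
    show "finite ?N"
      using N finite_bases finite_subset by blast
    show "\<forall>B\<in>?N. finite (?int B)"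
      using N finite_basis by (auto intro: finite_subset[of _ "Pow _"])
    show "\<forall>B\<in>?N. \<forall>B'\<in>?N. B \<noteq> B' \<longrightarrow> ?int B \<inter> ?int B' = {}"
    proof (intro ballI impI equals0I)
      fix B B' I assume "B \<in> ?N" "B' \<in> ?N" "B \<noteq> B'" "I \<in> ?int B \<inter> ?int B'"
      then show False
        using N QE_intervals_disjoint[OF assms(3), of B B' I] by auto
    qed
  qed
  also have "\<dots> = (\<Sum>B\<in>?N. x ^ r * inverse x ^ card (IA \<Delta> B))"
  proof (rule sum.cong[OF refl])
    fix B assume "B \<in> ?N"
    then have B: "card B = r" "finite B"
      using N card_basis finite_basis assms(2) by auto
    have IA: "IA \<Delta> B \<subseteq> B"
      by (auto simp: IA_def)
    have "(\<Sum>I\<in>?int B. ?w I) = x ^ card (B - IA \<Delta> B)"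
      using sum_interval_powers[of B "B - IA \<Delta> B" x] B by auto
    also have "card (B - IA \<Delta> B) = r - card (IA \<Delta> B)"
      using B IA by (simp add: card_Diff_subset finite_subset)
    \<comment> \<open>The bound \<open>card (IA \<Delta> B) \<le> r\<close> keeps the natural
      subtraction from truncating, and \<open>x \<noteq> 0\<close> permits the division.\<close>
    also have "x ^ (r - card (IA \<Delta> B)) = x ^ r * inverse x ^ card (IA \<Delta> B)"
      using assms(5) card_mono[OF B(2) IA] B(1)
      by (simp add: power_diff power_inverse divide_inverse)
    finally show "(\<Sum>I\<in>?int B. ?w I) = x ^ r * inverse x ^ card (IA \<Delta> B)" .
  qed
  also have "\<dots> = x ^ r * (\<Sum>B\<in>?N. inverse x ^ card (IA \<Delta> B))"
    by (simp add: sum_distrib_left)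
  also have "(\<Sum>B\<in>?N. inverse x ^ card (IA \<Delta> B)) = tutte E \<Delta> (inverse x) 0"
    unfolding tutte_def
  proof (rule sum.mono_neutral_cong_left)
    \<comment> \<open>An infinite set would have \<open>card\<close> 0, and
      \<open>0 ^ 0 = 1\<close>. With finiteness, \<open>0 ^ card (EA E \<Delta> B)\<close> is 1 on
      \<open>?N\<close> and 0 on the other bases.\<close>
    have "finite (EA E \<Delta> B)" for B
      using finite_E by (simp add: EA_def)
    then show "\<forall>B\<in>bases \<Delta> - ?N. inverse x ^ card (IA \<Delta> B) * 0 ^ card (EA E \<Delta> B) = 0"
      by (auto simp: nbc_bases_eq)
    show "inverse x ^ card (IA \<Delta> B) = inverse x ^ card (IA \<Delta> B) * 0 ^ card (EA E \<Delta> B)"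
      if "B \<in> ?N" for B
      using that by (simp add: nbc_bases_eq)
  qed (use N finite_bases in auto)
  finally show ?thesis .
qed

end
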